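(* For $r_0>0$ and $0<\theta_1<2\pi$ consider the conical domain $$\mathcal C(r_0,\theta_1)=\{r<r_0,\ \theta\in(0,\theta_1)\}\subset\mathbb R^2,$$ and let $\nu=(\nu_1,\nu_2)$ be a vector field defined on $\{\theta=0\}$ such that $\nu_2<0$. Then there exist $\gamma\in(0,1)$ and a $C^2$ function $\varphi:[0,\theta_1]\to\mathbb R$, satisfying $\varphi\ge c>0$ for a universal constant $c>0$, such that $w=r^\gamma\varphi(\theta)$ satisfies $$-|\nabla w|^\alpha F(x,\nabla w,D^2w)\ge c\,r^{\gamma-2+(\gamma-1)\alpha}\ \text{ in }\mathcal C(r_0,\theta_1),\qquad \frac{\partial w}{\partial\nu}\ge -c\,\nu_2\,r^{\gamma-1}\ \text{ on }\{\theta=0\}.$$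
   Context: Dimension $N=2$; $\alpha>-1$. For points $(x,y)\in\mathbb R^2$ the polar coordinates are $r=\sqrt{x^2+y^2}$ and $\theta=\arccos\frac{x}{r}$ if $y\ge0$, $\theta=2\pi-\arccos\frac xr$ if $y<0$. $\frac{\partial w}{\partial\nu}=\nabla w\cdot\nu$. The operator $F=F(x,p,M)$, with $x\in\overline{\mathcal C(r_0,\theta_1)}$ (here $x$ denotes the point of the plane), $p\in\mathbb R^2$, $M$ a symmetric $2\times2$ matrix, is real-valued and satisfies: (H1) $F(x,p,O)\equiv0$; (H2) there are $0<a\le A$ with $a\,\mathrm{tr}(P)\le F(x,p,M+P)-F(x,p,M)\le A\,\mathrm{tr}(P)$ for all $x,p,M$ and $P\ge0$; (H3) $|F(x,p,M)-F(x,q,M)|\le \mathrm{lip}_pF\,|p-q|$ for all $x,p,q,M$, for some constant $\mathrm{lip}_pF$; (H4) there are $\theta_F\in(\tfrac12,1)$, $c_F>0$ with $|F(x,p,M)-F(y,p,M)|\le c_F|M|\,|x-y|^{\theta_F}$ for all $x,y,p,M$ ($|M|$ = spectral radius).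
   Formalization: The vector field ν is assumed continuous on the closed side {θ=0}, 0≤r≤r₀ (vertex included), with ν₂<0 there; for arbitrary ν the claim fails, e.g. ν(t,0)=(−1/t,−1). *)

theory Defs
  imports "HOL-Analysis.Analysis"
begin

definition polar_r :: "real^2 \<Rightarrow> real" where
  "polar_r z = sqrt ((z$1)\<^sup>2 + (z$2)\<^sup>2)"

definition polar_angle :: "real^2 \<Rightarrow> real" where
  "polar_angle z =
     (if z$2 \<ge> 0 then arccos (z$1 / polar_r z) else 2 * pi - arccos (z$1 / polar_r z))"

text \<open>The origin has no polar angle, but \<open>polar_angle 0 = pi / 2\<close> because of the convention
  \<open>x / 0 = 0\<close>. Hence the origin is excluded explicitly.\<close>

definition conical_domain :: "real \<Rightarrow> real \<Rightarrow> (real^2) set" where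
  "conical_domain r\<^sub>0 \<theta>\<^sub>1 = {z. 0 < polar_r z \<and> polar_r z < r\<^sub>0 \<and> 0 < polar_angle z \<and> polar_angle z < \<theta>\<^sub>1}"

text \<open>The side \<open>\<theta> = 0\<close> of the cone, without the vertex.\<close>

definition cone_side :: "real \<Rightarrow> (real^2) set" where
  "cone_side r\<^sub>0 = {z. 0 < polar_r z \<and> polar_r z \<le> r\<^sub>0 \<and> polar_angle z = 0}"

definition symmetric_matrix :: "real^2^2 \<Rightarrow> bool" where
  "symmetric_matrix M \<longleftrightarrow> transpose M = M"

definition pos_semidef :: "real^2^2 \<Rightarrow> bool" where
  "pos_semidef P \<longleftrightarrow> symmetric_matrix P \<and> (\<forall>v. 0 \<le> v \<bullet> (P *v v))"

text \<open>Only used for symmetric matrices, all of whose eigenvalues are real.\<close>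

definition spec_radius :: "real^2^2 \<Rightarrow> real" where
  "spec_radius M = Max {\<bar>l\<bar> | l. \<exists>v. v \<noteq> 0 \<and> M *v v = l *\<^sub>R v}"

text \<open>The hypotheses (H1)--(H4) on an operator \<open>F x p M\<close> with \<open>x\<close> in \<open>D\<close>
  and \<open>M\<close> symmetric; the values of \<open>F\<close> elsewhere are irrelevant.\<close>

definition admissible_operator ::
    "real \<Rightarrow> real \<Rightarrow> real \<Rightarrow> real \<Rightarrow> real \<Rightarrow> (real^2) set
      \<Rightarrow> (real^2 \<Rightarrow> real^2 \<Rightarrow> real^2^2 \<Rightarrow> real) \<Rightarrow> bool" where
  "admissible_operator a A lip \<theta>\<^sub>F c\<^sub>F D F \<longleftrightarrow>
     (\<forall>x\<in>D. \<forall>p. F x p 0 = 0) \<and>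
     (\<forall>x\<in>D. \<forall>p M P. symmetric_matrix M \<longrightarrow> pos_semidef P \<longrightarrow>
        a * trace P \<le> F x p (M + P) - F x p M \<and> F x p (M + P) - F x p M \<le> A * trace P) \<and>
     (\<forall>x\<in>D. \<forall>p q M. symmetric_matrix M \<longrightarrow>
        \<bar>F x p M - F x q M\<bar> \<le> lip * norm (p - q)) \<and>
     (\<forall>x\<in>D. \<forall>y\<in>D. \<forall>p M. symmetric_matrix M \<longrightarrow>
        \<bar>F x p M - F y p M\<bar> \<le> c\<^sub>F * spec_radius M * norm (x - y) powr \<theta>\<^sub>F)"

text \<open>\<open>C\<^sup>2\<close> on a set that need not be open; on an interval \<open>{a..b}\<close> with \<open>a < b\<close>
  the derivatives at the end points are the one-sided ones.\<close>

definition C2_on :: "real set \<Rightarrow> (real \<Rightarrow> real) \<Rightarrow> bool" where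
  "C2_on S f \<longleftrightarrow> (\<exists>f' f''.
     (\<forall>t\<in>S. (f has_real_derivative f' t) (at t within S)) \<and>
     (\<forall>t\<in>S. (f' has_real_derivative f'' t) (at t within S)) \<and>
     continuous_on S f'')"

text \<open>\<open>g\<close> and \<open>H\<close> are the gradient and the Hessian of \<open>w\<close> on the open set \<open>S\<close>.\<close>

definition has_gradient_hessian_on ::
    "(real^2 \<Rightarrow> real) \<Rightarrow> (real^2 \<Rightarrow> real^2) \<Rightarrow> (real^2 \<Rightarrow> real^2^2) \<Rightarrow> (real^2) set \<Rightarrow> bool" where
  "has_gradient_hessian_on w g H S \<longleftrightarrow>
     (\<forall>z\<in>S. GDERIV w z :> g z \<and> (g has_derivative (\<lambda>h. H z *v h)) (at z))"

definition barrier :: "real \<Rightarrow> (real \<Rightarrow> real) \<Rightarrow> real^2 \<Rightarrow> real" where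
  "barrier \<gamma> \<phi> z = polar_r z powr \<gamma> * \<phi> (polar_angle z)"

text \<open>\<open>- |\<nabla>w|\<^sup>\<alpha> F(x, \<nabla>w, D\<^sup>2w) \<ge> f\<close> pointwise on the open set \<open>S\<close>.
  For \<open>f > 0\<close> this forces \<open>\<nabla>w \<noteq> 0\<close> because \<open>0 powr \<alpha> = 0\<close> for every \<open>\<alpha>\<close>,
  so neither the singularity of \<open>|\<nabla>w|\<^sup>\<alpha>\<close> for \<open>\<alpha> < 0\<close>
  nor the case \<open>\<alpha> = 0\<close> plays a role.\<close>

definition supersolution_on ::
    "real \<Rightarrow> (real^2 \<Rightarrow> real^2 \<Rightarrow> real^2^2 \<Rightarrow> real) \<Rightarrow> (real^2 \<Rightarrow> real) \<Rightarrow> (real^2 \<Rightarrow> real)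
      \<Rightarrow> (real^2) set \<Rightarrow> bool" where
  "supersolution_on \<alpha> F f w S \<longleftrightarrow>
     (\<exists>g H. has_gradient_hessian_on w g H S \<and>
        (\<forall>z\<in>S. - (norm (g z) powr \<alpha>) * F z (g z) (H z) \<ge> f z))"

text \<open>\<open>\<partial>w/\<partial>\<nu> = \<nabla>w \<cdot> \<nu> \<ge> b\<close> at the boundary point \<open>z\<close> of \<open>S\<close>. The function \<open>w\<close> is only given
  on \<open>closure S\<close> and \<open>\<nu>\<close> may point out of it, so \<open>\<nabla>w\<close> is the gradient within \<open>closure S\<close>;
  it is unique at points of the sides of a cone other than the vertex.\<close>

definition oblique_derivative_ge ::
    "(real^2 \<Rightarrow> real) \<Rightarrow> real^2 \<Rightarrow> real \<Rightarrow> real^2 \<Rightarrow> (real^2) set \<Rightarrow> bool" where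
  "oblique_derivative_ge w n b z S \<longleftrightarrow>
     (\<exists>g. (w has_derivative (\<lambda>h. h \<bullet> g)) (at z within closure S) \<and> g \<bullet> n \<ge> b)"

end

theory Submission
  imports Defs
begin

text \<open>Take \<open>\<phi> t = C - exp (L * t) / L\<close> with \<open>L = A / a + 1\<close>. For \<open>\<gamma>\<close> close to 0 the Hessian of
  \<open>w = r\<^sup>\<gamma> \<phi>(\<theta>)\<close> in the frame \<open>(e\<^sub>r, e\<^sub>\<theta>)\<close> is \<open>r\<^sup>\<gamma>\<^sup>-\<^sup>2\<close> times approximately
  \<open>[[0, E], [E, - L * E]]\<close>, where \<open>E = exp (L * \<theta>)\<close>. It is the difference of the rank-one matrix
  \<open>P = r\<^sup>\<gamma>\<^sup>-\<^sup>2 E e\<^sub>r e\<^sub>r\<^sup>T\<close> and a positive semidefinite matrix of so much larger trace that (H1) and (H2)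
  give \<open>F(x, \<nabla>w, D\<^sup>2w) \<le> - a * E * r\<^sup>\<gamma>\<^sup>-\<^sup>2\<close>. As \<open>- \<phi>' \<ge> 1\<close>, the gradient is comparable to \<open>r\<^sup>\<gamma>\<^sup>-\<^sup>1\<close>,
  and on \<open>\<theta> = 0\<close> the term \<open>\<phi>'(0) * \<nu>\<^sub>2 = - \<nu>\<^sub>2\<close> absorbs \<open>\<gamma> * \<phi>(0) * \<nu>\<^sub>1\<close> for small \<open>\<gamma>\<close>. Only \<open>\<gamma>\<close> depends
  on \<open>\<nu>\<close>.\<close>

section \<open>Polar coordinates as norm and complex argument\<close>

lemma polar_r_eq_norm: "polar_r z = norm z"
  by (simp add: polar_r_def norm_vec_def L2_set_def sum_2)

lemma inner_real2: "(u::real^2) \<bullet> v = u$1 * v$1 + u$2 * v$2"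
  by (simp add: inner_vec_def sum_2)

lemma power2_norm_real2: "(norm (z::real^2))\<^sup>2 = (z$1)\<^sup>2 + (z$2)\<^sup>2"
  unfolding power2_norm_eq_inner by (simp add: inner_real2 power2_eq_square)

text \<open>The link to complex analysis: differentiability of the angle can then be taken from
  \<open>Ln\<close>.\<close>

lemma polar_angle_eq_Arg2pi:
  assumes "z \<noteq> 0"
  shows "polar_angle z = Arg2pi (Complex (z$1) (z$2))"
proof -
  define r where "r = polar_r z"
  have r: "r > 0" "r\<^sup>2 = (z$1)\<^sup>2 + (z$2)\<^sup>2"
    using assms by (auto simp: r_def polar_r_eq_norm power2_norm_real2)
  have le: "\<bar>z$1\<bar> \<le> r"
    using r by (intro power2_le_imp_le[of "\<bar>z$1\<bar>"]) auto
  have b: "-1 \<le> z$1 / r" "z$1 / r \<le> 1"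
    using le r(1) by (auto simp: field_simps)
  have "1 - (z$1 / r)\<^sup>2 = (r\<^sup>2 - (z$1)\<^sup>2) / r\<^sup>2"
    using r(1) by (simp add: power_divide diff_divide_distrib)
  then have "1 - (z$1 / r)\<^sup>2 = (\<bar>z$2\<bar> / r)\<^sup>2"
    using r(2) by (simp add: power_divide)
  then have s: "sin (arccos (z$1 / r)) = \<bar>z$2\<bar> / r"
    using b r by (simp add: sin_arccos real_sqrt_unique)
  have c: "cos (arccos (z$1 / r)) = z$1 / r"
    using b by (simp add: cos_arccos)
  \<comment> \<open>Below the axis the sine \<open>\<bar>z$2\<bar> / r\<close> is nonzero, so
    \<open>2 * pi - arccos\<close> stays strictly below \<open>2 * pi\<close>, as uniqueness of
    \<open>Arg2pi\<close> demands.\<close>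
  have pos: "arccos (z$1 / r) > 0" if "z$2 < 0"
    using s that r arccos_lbound[OF b] by (cases "arccos (z$1 / r) = 0") auto
  show ?thesis
  proof (rule Arg2pi_unique[symmetric, where r = r])
    show "of_real r * exp (\<i> * of_real (polar_angle z)) = Complex (z$1) (z$2)"
      using r(1) s c by (simp add: complex_eq_iff Re_exp Im_exp polar_angle_def r_def[symmetric] cos_diff sin_diff)
    show "0 \<le> polar_angle z" "polar_angle z < 2 * pi"
      using arccos_lbound[OF b] arccos_ubound[OF b] pos pi_gt_zero
      unfolding polar_angle_def r_def[symmetric] by (smt (verit))+
  qed (use r in simp)
qed

section \<open>First and second derivatives in polar coordinates\<close>

text \<open>Rotation by a right angle: \<open>perp z\<close> is r times the angular unit vector, and
  \<open>perp z\<close> over \<open>(norm z)\<^sup>2\<close> is the gradient of the angle.\<close>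

definition perp :: "real^2 \<Rightarrow> real^2" where
  "perp z = vector [- z$2, z$1]"

lemma perp_nth [simp]: "perp z $ 1 = - z$2" "perp z $ 2 = z$1"
  by (simp_all add: perp_def)

lemma bounded_linear_perp: "bounded_linear perp"
  by (intro linear_conv_bounded_linear[THEN iffD1] linearI) (simp_all add: vec_eq_iff forall_2)

text \<open>The sign of \<open>s\<close> selects the branch cut: the negative half-line for \<open>s > 0\<close>, and the positive one,
  as for \<open>polar_angle\<close>, for \<open>s < 0\<close>.\<close>

lemma Im_Ln_has_derivative:
  fixes z :: "real^2" and s :: real
  assumes "of_real s * Complex (z$1) (z$2) \<notin> \<real>\<^sub>\<le>\<^sub>0" and "s \<noteq> 0"
  shows "((\<lambda>u. Im (Ln (of_real s * Complex (u$1) (u$2)))) has_derivative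
    (\<lambda>h. (perp z \<bullet> h) / (norm z)\<^sup>2)) (at z within S)"
proof -
  have lin: "((\<lambda>u::real^2. of_real s * Complex (u$1) (u$2)) has_derivative
      (\<lambda>h. of_real s * Complex (h$1) (h$2))) (at z within S)"
    unfolding Complex_eq
    by (intro derivative_intros bounded_linear_imp_has_derivative bounded_linear_vec_nth)
  have "((\<lambda>u. Im (Ln (of_real s * Complex (u$1) (u$2)))) has_derivative
     (\<lambda>h. Im (inverse (of_real s * Complex (z$1) (z$2)) * (of_real s * Complex (h$1) (h$2))))) (at z within S)"
    using has_derivative_compose[OF lin has_field_derivative_Ln[OF assms(1), unfolded has_field_derivative_def]]
    by (rule has_derivative_Im)
  moreover have "Im (inverse (of_real s * Complex (z$1) (z$2)) * (of_real s * Complex (h$1) (h$2)))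
      = (perp z \<bullet> h) / (norm z)\<^sup>2" for h :: "real^2"
  \<comment> \<open>The factor \<open>s\<close> cancels, so both branches have the derivative Im (h
    / z).\<close>
  proof -
    have "inverse (of_real s * Complex (z$1) (z$2)) * (of_real s * Complex (h$1) (h$2))
      = Complex (h$1) (h$2) / Complex (z$1) (z$2)"
      using assms by (simp add: divide_inverse)
    then show ?thesis
      by (simp add: Im_divide power2_norm_real2 inner_real2)
  qed
  ultimately show ?thesis by simp
qed

lemma powr_eq_mult_power2: "x powr b = x powr (b - 2) * x\<^sup>2" if "0 < x" for x b :: real
  using that by (simp add: powr_diff)

lemma norm_powr_has_derivative:
  fixes z :: "'a::real_inner"
  assumes "z \<noteq> 0"
  shows "((\<lambda>u. norm u powr b) has_derivative (\<lambda>h. b * norm z powr (b - 2) * (z \<bullet> h))) (at z within S)"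
proof -
  have n: "(norm has_derivative (\<lambda>h. h \<bullet> sgn z)) (at z within S)"
    using has_derivative_norm[OF assms] by (simp add: has_derivative_at_withinI gderiv_def)
  have "((\<lambda>x. x powr b) has_real_derivative b * norm z powr (b - 1)) (at (norm z))"
    using assms by (simp add: has_real_derivative_powr)
  from has_derivative_compose[OF n this[unfolded has_field_derivative_def]]
  have "((\<lambda>u. norm u powr b) has_derivative (\<lambda>h. b * norm z powr (b - 1) * (h \<bullet> sgn z))) (at z within S)" .
  moreover have "norm z powr (b - 1) = norm z powr (b - 2) * norm z"
    using powr_add[of "norm z" "b - 2" 1] by simp
  ultimately show ?thesis
    using assms by (simp add: sgn_div_norm inner_commute field_simps)
qed

text \<open>Gradient and Hessian of \<open>r\<^sup>\<gamma> \<phi>(\<theta>)\<close> at \<open>z\<close>, where \<open>p\<close>, \<open>p'\<close>, \<open>p''\<close> stand for the values of \<open>\<phi>\<close>,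
  \<open>\<phi>'\<close>, \<open>\<phi>''\<close> at the polar angle of \<open>z\<close>.\<close>

definition polar_grad :: "real \<Rightarrow> real^2 \<Rightarrow> real \<Rightarrow> real \<Rightarrow> real^2" where
  "polar_grad \<gamma> z p p' = norm z powr (\<gamma> - 2) *\<^sub>R ((\<gamma> * p) *\<^sub>R z + p' *\<^sub>R perp z)"

definition polar_hess :: "real \<Rightarrow> real^2 \<Rightarrow> real \<Rightarrow> real \<Rightarrow> real \<Rightarrow> real^2^2" where
  "polar_hess \<gamma> z p p' p'' = (\<chi> i j. norm z powr (\<gamma> - 4) *
     (\<gamma> * (\<gamma> - 1) * p * (z$i * z$j) + (\<gamma> - 1) * p' * (z$i * perp z$j + perp z$i * z$j)
      + (p'' + \<gamma> * p) * (perp z$i * perp z$j)))"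

text \<open>The set \<open>S\<close> is left free because the chain rule is needed twice: at
  interior points of the cone, and within its closure on the side.\<close>

lemma polar_has_gradient:
  assumes "z \<noteq> 0"
    and "(\<Theta> has_derivative (\<lambda>h. (perp z \<bullet> h) / (norm z)\<^sup>2)) (at z within S)"
    and "(\<phi> has_real_derivative p') (at (\<Theta> z))"
  shows "((\<lambda>u. norm u powr \<gamma> * \<phi> (\<Theta> u)) has_derivative (\<lambda>h. h \<bullet> polar_grad \<gamma> z (\<phi> (\<Theta> z)) p'))
    (at z within S)"
proof -
  have 1: "((\<lambda>u. \<phi> (\<Theta> u)) has_derivative (\<lambda>h. p' * ((perp z \<bullet> h) / (norm z)\<^sup>2))) (at z within S)"
    by (rule has_derivative_compose[OF assms(2) assms(3)[unfolded has_field_derivative_def]])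
  show ?thesis
    by (rule has_derivative_eq_rhs[OF has_derivative_mult[OF norm_powr_has_derivative[OF assms(1)] 1]])
      (use assms(1) in \<open>simp add: fun_eq_iff polar_grad_def inner_add_right inner_commute
        powr_eq_mult_power2[of "norm z" \<gamma>] algebra_simps\<close>)
qed

lemma polar_grad_has_derivative:
  assumes z: "z \<noteq> 0"
    and "(\<Theta> has_derivative (\<lambda>h. (perp z \<bullet> h) / (norm z)\<^sup>2)) (at z within S)"
    and "(\<phi> has_real_derivative \<phi>' (\<Theta> z)) (at (\<Theta> z))"
    and "(\<phi>' has_real_derivative p'') (at (\<Theta> z))"
  shows "((\<lambda>u. polar_grad \<gamma> u (\<phi> (\<Theta> u)) (\<phi>' (\<Theta> u))) has_derivative
    (\<lambda>h. polar_hess \<gamma> z (\<phi> (\<Theta> z)) (\<phi>' (\<Theta> z)) p'' *v h)) (at z within S)"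
proof -
  have 1: "((\<lambda>u. \<phi> (\<Theta> u)) has_derivative (\<lambda>h. \<phi>' (\<Theta> z) * ((perp z \<bullet> h) / (norm z)\<^sup>2))) (at z within S)"
    by (rule has_derivative_compose[OF assms(2) assms(3)[unfolded has_field_derivative_def]])
  have 2: "((\<lambda>u. \<phi>' (\<Theta> u)) has_derivative (\<lambda>h. p'' * ((perp z \<bullet> h) / (norm z)\<^sup>2))) (at z within S)"
    by (rule has_derivative_compose[OF assms(2) assms(4)[unfolded has_field_derivative_def]])
  have 3: "norm z powr (\<gamma> - 2) = norm z powr (\<gamma> - 4) * (norm z)\<^sup>2"
    using z powr_eq_mult_power2[of "norm z" "\<gamma> - 2"] by simp
  \<comment> \<open>\<open>q\<close> stays opaque while denominators are cleared. Expanding it by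
    \<open>q'\<close> then leaves a polynomial identity, which amounts to writing h and
    \<open>perp h\<close> in the orthogonal basis \<open>z\<close>, \<open>perp z\<close>.\<close>
  define q where "q = (norm z)\<^sup>2"
  have q: "q \<noteq> 0" using z by (simp add: q_def)
  have q': "q = z$1 * z$1 + z$2 * z$2" unfolding q_def power2_norm_real2 by (simp add: power2_eq_square)
  show ?thesis
    unfolding polar_grad_def
  proof (rule has_derivative_eq_rhs)
    show "((\<lambda>u. norm u powr (\<gamma> - 2) *\<^sub>R ((\<gamma> * \<phi> (\<Theta> u)) *\<^sub>R u + \<phi>' (\<Theta> u) *\<^sub>R perp u)) has_derivative
      (\<lambda>h. norm z powr (\<gamma> - 2) *\<^sub>R
          ((\<gamma> * \<phi> (\<Theta> z)) *\<^sub>R h + (\<gamma> * (\<phi>' (\<Theta> z) * ((perp z \<bullet> h) / (norm z)\<^sup>2))) *\<^sub>R z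
           + (\<phi>' (\<Theta> z) *\<^sub>R perp h + (p'' * ((perp z \<bullet> h) / (norm z)\<^sup>2)) *\<^sub>R perp z))
        + ((\<gamma> - 2) * norm z powr (\<gamma> - 2 - 2) * (z \<bullet> h)) *\<^sub>R
          ((\<gamma> * \<phi> (\<Theta> z)) *\<^sub>R z + \<phi>' (\<Theta> z) *\<^sub>R perp z))) (at z within S)"
      by (rule has_derivative_scaleR[OF norm_powr_has_derivative[OF z]
            has_derivative_add[OF has_derivative_scaleR[OF has_derivative_mult_right[OF 1] has_derivative_ident]
              has_derivative_scaleR[OF 2 bounded_linear_imp_has_derivative[OF bounded_linear_perp]]]])
  qed (use q in \<open>simp add: fun_eq_iff vec_eq_iff forall_2 polar_hess_def matrix_vector_mult_def
      sum_2 3 q_def[symmetric] inner_real2 field_simps, simp add: q' algebra_simps\<close>)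
qed

section \<open>Differentiability of the polar angle inside the cone and on its side\<close>

lemma polar_angle_nonneg: "z \<noteq> 0 \<Longrightarrow> 0 \<le> polar_angle z"
  by (simp add: polar_angle_eq_Arg2pi Arg2pi_ge_0)

lemma polar_angle_eq_0_iff: "z \<noteq> 0 \<Longrightarrow> polar_angle z = 0 \<longleftrightarrow> z$2 = 0 \<and> 0 < z$1"
  by (auto simp: polar_angle_eq_Arg2pi Arg2pi_eq_0 complex_is_Real_iff vec_eq_iff forall_2)

text \<open>Off the closed positive half-line the angle equals Im (Ln (-u)) + pi, which is smooth
  there.\<close>

lemma polar_angle_has_derivative:
  assumes "z \<noteq> 0" and "polar_angle z \<noteq> 0"
  shows "(polar_angle has_derivative (\<lambda>h. (perp z \<bullet> h) / (norm z)\<^sup>2)) (at z)"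
proof -
  define U :: "(real^2) set" where "U = - ({u. u$2 = 0} \<inter> {u. 0 \<le> u$1})"
  have "open U"
    unfolding U_def by (intro open_Compl closed_Int closed_Collect_eq closed_Collect_le continuous_intros)
  have zU: "z \<in> U"
    using assms polar_angle_eq_0_iff[of z] by (auto simp: U_def vec_eq_iff forall_2)
  have slit: "of_real (-1) * Complex (u$1) (u$2) \<notin> \<real>\<^sub>\<le>\<^sub>0" if "u \<in> U" for u
    using that by (auto simp: U_def complex_nonpos_Reals_iff)
  have eq: "Im (Ln (of_real (-1) * Complex (u$1) (u$2))) + pi = polar_angle u" if "u \<in> U" for u
  proof -
    have "u \<noteq> 0"
      using that by (auto simp: U_def)
    moreover from this have "polar_angle u \<noteq> 0"
      using that polar_angle_eq_0_iff[of u] by (auto simp: U_def)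
    ultimately show ?thesis
      using polar_angle_nonneg[of u] Arg2pi_Ln[of "Complex (u$1) (u$2)"]
      by (simp add: polar_angle_eq_Arg2pi)
  qed
  have "((\<lambda>u. Im (Ln (of_real (-1) * Complex (u$1) (u$2))) + pi) has_derivative
      (\<lambda>h. (perp z \<bullet> h) / (norm z)\<^sup>2)) (at z)"
    using has_derivative_add[OF Im_Ln_has_derivative[OF slit[OF zU]] has_derivative_const[of pi]] by simp
  then show ?thesis
    by (rule has_derivative_transform_within_open[OF _ \<open>open U\<close> zU eq])
qed

text \<open>Because \<open>\<theta>\<^sub>1 < 2 * pi\<close>, a sector just below the positive
  half-line is missed. The condition is phrased with non-strict inequalities so that it is closed
  and passes to the closure.\<close>

lemma closure_conical_domain_near_side:
  assumes "\<theta>\<^sub>1 < 2 * pi"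
  obtains k where "k < 1" "\<And>z. z \<in> closure (conical_domain r\<^sub>0 \<theta>\<^sub>1) \<Longrightarrow> 0 \<le> z$2 \<or> z$1 \<le> k * norm z"
proof
  \<comment> \<open>Points of the cone below the axis make at least the angle
    \<open>2 * pi - \<theta>\<^sub>1\<close> with the positive half-line; the cap \<open>pi\<close>
    keeps \<open>d\<close> where the cosine decreases.\<close>
  define d where "d = min pi (2 * pi - \<theta>\<^sub>1)"
  have d: "0 < d" "d \<le> pi" using assms by (auto simp: d_def)
  show "cos d < 1"
    using cos_monotone_0_pi[of 0 d] d by simp
  have "conical_domain r\<^sub>0 \<theta>\<^sub>1 \<subseteq> {z. 0 \<le> z$2} \<union> {z. z$1 \<le> cos d * norm z}"
  proof
    fix z assume z: "z \<in> conical_domain r\<^sub>0 \<theta>\<^sub>1"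
    then have pos: "0 < norm z" by (simp add: conical_domain_def polar_r_eq_norm)
    have b: "-1 \<le> z$1 / norm z" "z$1 / norm z \<le> 1"
      using component_le_norm_cart[of z 1] pos by (auto simp: field_simps)
    show "z \<in> {z. 0 \<le> z$2} \<union> {z. z$1 \<le> cos d * norm z}"
    proof (cases "0 \<le> z$2")
      case False
      then have "d \<le> arccos (z$1 / norm z)"
        using z by (auto simp: conical_domain_def polar_angle_def polar_r_eq_norm d_def)
      then have "cos (arccos (z$1 / norm z)) \<le> cos d"
        using d arccos_ubound[OF b] by (intro cos_monotone_0_pi_le) auto
      then show ?thesis
        using b pos by (simp add: cos_arccos pos_divide_le_eq)
    qed simp
  qed
  moreover have "closed ({z::real^2. 0 \<le> z$2} \<union> {z. z$1 \<le> cos d * norm z})"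
    by (intro closed_Un closed_Collect_le continuous_intros)
  ultimately show "0 \<le> z$2 \<or> z$1 \<le> cos d * norm z"
    if "z \<in> closure (conical_domain r\<^sub>0 \<theta>\<^sub>1)" for z
    using closure_minimal that by blast
qed

text \<open>The angle jumps across the positive half-line, but near \<open>z\<close> the closure of
  the cone lies in the upper half-plane, where the angle is the principal argument.\<close>

lemma polar_angle_has_derivative_side:
  assumes "\<theta>\<^sub>1 < 2 * pi" and z: "z \<noteq> 0" "polar_angle z = 0"
  shows "(polar_angle has_derivative (\<lambda>h. (perp z \<bullet> h) / (norm z)\<^sup>2))
    (at z within closure (conical_domain r\<^sub>0 \<theta>\<^sub>1))"
proof -
  obtain k where k: "k < 1"
    "\<And>u. u \<in> closure (conical_domain r\<^sub>0 \<theta>\<^sub>1) \<Longrightarrow> 0 \<le> u$2 \<or> u$1 \<le> k * norm u"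
    using closure_conical_domain_near_side[OF assms(1)] by blast
  have z12: "z$2 = 0" "0 < z$1" using z polar_angle_eq_0_iff by auto
  then have norm_z: "norm z = z$1"
    by (simp add: norm_vec_def L2_set_def sum_2)
  \<comment> \<open>On this neighbourhood the alternative \<open>u$1 \<le> k * norm u\<close> fails;
    it contains \<open>z\<close> since \<open>k < 1\<close>.\<close>
  define U :: "(real^2) set" where "U = {u. 0 < u$1} \<inter> {u. k * norm u < u$1}"
  have "open U"
    unfolding U_def by (intro open_Int open_Collect_less continuous_intros)
  moreover have zU: "z \<in> U"
    using z12 k(1) by (simp add: U_def norm_z)
  ultimately obtain e where e: "0 < e" "ball z e \<subseteq> U"
    by (meson openE)
  have eq: "Im (Ln (of_real 1 * Complex (u$1) (u$2))) = polar_angle u" if "0 < u$1" "0 \<le> u$2" for u :: "real^2"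
  proof -
    define w where "w = Complex (u$1) (u$2)"
    have w: "w \<noteq> 0" "0 \<le> Im w" "u \<noteq> 0" using that by (auto simp: w_def complex_eq_iff)
    have "Arg w = Arg2pi w"
      using w Arg2pi_eq[of w] Arg2pi_le_pi[of w] less_le_trans[OF _ Arg2pi_ge_0, of "- pi" w]
      by (intro Arg_unique[of "cmod w"]) auto
    then show ?thesis
      using w Arg_eq_Im_Ln[of w] by (simp add: w_def polar_angle_eq_Arg2pi)
  qed
  \<comment> \<open>The transformation rule wants \<open>z\<close> in the set, and \<open>z\<close>
    may lie outside the closure since its norm is not bounded by \<open>r\<^sub>0\<close>.\<close>
  let ?S = "insert z (closure (conical_domain r\<^sub>0 \<theta>\<^sub>1))"
  have "((\<lambda>u. Im (Ln (of_real 1 * Complex (u$1) (u$2)))) has_derivative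
      (\<lambda>h. (perp z \<bullet> h) / (norm z)\<^sup>2)) (at z within ?S)"
    using z12 by (intro Im_Ln_has_derivative) (auto simp: complex_nonpos_Reals_iff)
  then have "(polar_angle has_derivative (\<lambda>h. (perp z \<bullet> h) / (norm z)\<^sup>2)) (at z within ?S)"
  proof (rule has_derivative_transform_within[OF _ e(1)])
    fix u assume "u \<in> ?S" "dist u z < e"
    then have "u \<in> U" "u = z \<or> 0 \<le> u$2 \<or> u$1 \<le> k * norm u"
      using e(2) k(2) by (auto simp: dist_commute)
    then show "Im (Ln (of_real 1 * Complex (u$1) (u$2))) = polar_angle u"
      using z12 by (intro eq) (auto simp: U_def)
  qed simp
  then show ?thesis
    by (rule has_derivative_subset) auto
qed

section \<open>Ellipticity applied to the Hessian of the barrier\<close>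

text \<open>Reach \<open>P\<close> in two ways: from 0, with the upper bound of (H2), and from
  \<open>M\<close> by adding \<open>P - M\<close>, with the lower bound.\<close>

lemma admissible_operator_upper:
  assumes "admissible_operator a A lip \<theta>\<^sub>F c\<^sub>F D F" and "x \<in> D"
    and "symmetric_matrix M" and "pos_semidef P" and "pos_semidef (P - M)"
  shows "F x p M \<le> A * trace P - a * trace (P - M)"
proof -
  have sym0: "symmetric_matrix 0"
    by (simp add: symmetric_matrix_def transpose_def vec_eq_iff)
  have H1: "F x p 0 = 0"
    and H2: "\<And>M P. symmetric_matrix M \<Longrightarrow> pos_semidef P \<Longrightarrow>
      a * trace P \<le> F x p (M + P) - F x p M \<and> F x p (M + P) - F x p M \<le> A * trace P"
    using assms(1,2) unfolding admissible_operator_def by blast+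
  show ?thesis
    using H2[OF sym0 assms(4)] H2[OF assms(3,5)] H1 by simp
qed

lemma admissible_operator_polar_hess:
  fixes E p \<gamma> :: real
  assumes F: "admissible_operator a A lip \<theta>\<^sub>F c\<^sub>F D F" "z \<in> D"
    and z: "z \<noteq> 0" and a: "0 < a" "a \<le> A"
    and \<gamma>: "0 < \<gamma>" "\<gamma> < 1" and p: "0 \<le> p" "\<gamma> * p \<le> E"
  shows "F z q (polar_hess \<gamma> z p (- E) (- ((A / a + 1) * E))) \<le> - a * E * norm z powr (\<gamma> - 2)"
proof -
  define L where "L = A / a + 1"
  define T where "T = norm z powr (\<gamma> - 4)"
  define H where "H = polar_hess \<gamma> z p (- E) (- (L * E))"
  define P :: "real^2^2" where "P = (\<chi> i j. T * E * (z$i * z$j))"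
  have L: "2 \<le> L" using a by (simp add: L_def)
  have E: "0 \<le> E" using p \<gamma> by (meson mult_nonneg_nonneg less_imp_le order.trans)
  have T: "0 \<le> T" by (simp add: T_def)
  have \<gamma>2: "\<gamma> * (\<gamma> * p) \<le> E"
    using mult_mono[of \<gamma> 1 "\<gamma> * p" E] \<gamma> p E by simp
  have quad_P: "v \<bullet> (P *v v) = T * E * (z \<bullet> v)\<^sup>2" for v
    by (simp add: P_def matrix_vector_mult_def inner_real2 sum_2 power2_eq_square algebra_simps)
  \<comment> \<open>The quadratic form in the coordinates \<open>z \<bullet> v\<close> and
    \<open>perp z \<bullet> v\<close>: only the mixed term has no sign, and it is absorbed by one
    \<open>E\<close> from each square.\<close>
  have quad_PH: "v \<bullet> ((P - H) *v v) = T * ((E + \<gamma> * (1 - \<gamma>) * p) * (z \<bullet> v)\<^sup>2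
      - 2 * (1 - \<gamma>) * E * (z \<bullet> v) * (perp z \<bullet> v) + (L * E - \<gamma> * p) * (perp z \<bullet> v)\<^sup>2)" for v
    by (simp add: P_def H_def polar_hess_def T_def[symmetric] matrix_vector_mult_def inner_real2 sum_2
        power2_eq_square algebra_simps)
  have sym: "symmetric_matrix H" "symmetric_matrix P" "symmetric_matrix (P - H)"
    by (simp_all add: symmetric_matrix_def transpose_def vec_eq_iff forall_2 H_def P_def polar_hess_def
        mult.commute add.commute)
  have "0 \<le> v \<bullet> ((P - H) *v v)" for v
  proof -
    define s where "s = z \<bullet> v"
    define t where "t = perp z \<bullet> v"
    have "(1 - \<gamma>) * (2 * s * t) \<le> s\<^sup>2 + t\<^sup>2"
    proof -
      have "(1 - \<gamma>) * (2 * s * t) \<le> (1 - \<gamma>) * (s\<^sup>2 + t\<^sup>2)"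
        using \<gamma> sum_squares_bound[of s t] by (intro mult_left_mono) auto
      also have "\<dots> \<le> 1 * (s\<^sup>2 + t\<^sup>2)"
        using \<gamma> by (intro mult_right_mono) auto
      finally show ?thesis by simp
    qed
    then have "E * ((1 - \<gamma>) * (2 * s * t)) \<le> E * (s\<^sup>2 + t\<^sup>2)"
      by (rule mult_left_mono[OF _ E])
    moreover have "E * s\<^sup>2 \<le> (E + \<gamma> * (1 - \<gamma>) * p) * s\<^sup>2"
      using \<gamma> p by (intro mult_right_mono) auto
    \<comment> \<open>Here \<open>2 \<le> L\<close> matters: one \<open>E\<close> pays for
      \<open>\<gamma> * p\<close>, the other for the mixed term.\<close>
    moreover have "E * t\<^sup>2 \<le> (L * E - \<gamma> * p) * t\<^sup>2"
      using mult_right_mono[OF L E] p by (intro mult_right_mono) auto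
    ultimately show ?thesis
      unfolding quad_PH s_def[symmetric] t_def[symmetric]
      by (intro mult_nonneg_nonneg[OF T]) (simp add: algebra_simps)
  qed
  then have "F z q H \<le> A * trace P - a * trace (P - H)"
    using sym E T by (intro admissible_operator_upper[OF F]) (auto simp: pos_semidef_def quad_P)
  also have "trace P = T * (norm z)\<^sup>2 * E"
    unfolding power2_norm_real2 by (simp add: P_def trace_def sum_2 power2_eq_square algebra_simps)
  also have "trace (P - H) = T * (norm z)\<^sup>2 * ((L + 1) * E - \<gamma> * (\<gamma> * p))"
    unfolding power2_norm_real2
    by (simp add: P_def H_def polar_hess_def T_def[symmetric] trace_def sum_2 power2_eq_square algebra_simps)
  also have "T * (norm z)\<^sup>2 = norm z powr (\<gamma> - 2)"
    using z powr_eq_mult_power2[of "norm z" "\<gamma> - 2"] by (simp add: T_def)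
  \<comment> \<open>The surplus \<open>E - \<gamma> * (\<gamma> * p)\<close> is dropped; then
    \<open>a * L = A + a\<close> leaves exactly \<open>- a * E\<close>.\<close>
  also have "A * (norm z powr (\<gamma> - 2) * E) - a * (norm z powr (\<gamma> - 2) * ((L + 1) * E - \<gamma> * (\<gamma> * p)))
      \<le> A * (norm z powr (\<gamma> - 2) * E) - a * (norm z powr (\<gamma> - 2) * (L * E))"
    using a \<gamma>2 by (intro diff_left_mono mult_left_mono) (auto simp: algebra_simps)
  also have "\<dots> = - a * E * norm z powr (\<gamma> - 2)"
    using a by (simp add: L_def field_simps)
  finally show ?thesis
    by (simp add: H_def L_def)
qed

section \<open>Size of the gradient and control of the oblique field\<close>

lemma norm_polar_grad:
  assumes "z \<noteq> 0"
  shows "norm (polar_grad \<gamma> z p p') = norm z powr (\<gamma> - 1) * sqrt ((\<gamma> * p)\<^sup>2 + p'\<^sup>2)"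
proof -
  have "(norm ((\<gamma> * p) *\<^sub>R z + p' *\<^sub>R perp z))\<^sup>2 = ((\<gamma> * p)\<^sup>2 + p'\<^sup>2) * (norm z)\<^sup>2"
    unfolding power2_norm_real2 by (simp add: power2_eq_square algebra_simps)
  then have "norm ((\<gamma> * p) *\<^sub>R z + p' *\<^sub>R perp z) = sqrt ((\<gamma> * p)\<^sup>2 + p'\<^sup>2) * norm z"
    by (metis norm_ge_zero real_sqrt_abs abs_of_nonneg real_sqrt_mult)
  moreover have "norm z powr (\<gamma> - 1) = norm z powr (\<gamma> - 2) * norm z"
    using assms powr_add[of "norm z" "\<gamma> - 2" 1] by simp
  ultimately show ?thesis
    by (simp add: polar_grad_def)
qed

text \<open>Treats both signs of \<alpha> at once, with a bound that depends on \<open>G\<close> and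
  \<alpha> only.\<close>

lemma powr_ge_powr_minus_abs:
  fixes m G \<alpha> :: real
  assumes "1 \<le> m" "m \<le> G"
  shows "G powr (- \<bar>\<alpha>\<bar>) \<le> m powr \<alpha>"
proof -
  have "G powr (- \<bar>\<alpha>\<bar>) \<le> m powr (- \<bar>\<alpha>\<bar>)"
    using assms by (intro powr_mono2') auto
  also have "\<dots> \<le> m powr \<alpha>"
    using assms by (intro powr_mono) auto
  finally show ?thesis .
qed

text \<open>Compactness of the closed side, vertex included, bounds the ratio of the components;
  this makes one \<gamma> work at all its points.\<close>

lemma bounded_ratio_on_cone_side:
  fixes \<nu> :: "real^2 \<Rightarrow> real^2"
  assumes "continuous_on (closure (cone_side r\<^sub>0)) \<nu>" and neg: "\<forall>z\<in>closure (cone_side r\<^sub>0). \<nu> z $ 2 < 0"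
  obtains K where "0 < K" "\<And>z. z \<in> cone_side r\<^sub>0 \<Longrightarrow> \<bar>\<nu> z $ 1\<bar> \<le> K * - \<nu> z $ 2"
proof -
  let ?S = "closure (cone_side r\<^sub>0)"
  have "bounded (cone_side r\<^sub>0)"
    by (rule boundedI[of _ r\<^sub>0]) (auto simp: cone_side_def polar_r_eq_norm)
  then have "compact ?S" by simp
  moreover have "continuous_on ?S (\<lambda>z. \<nu> z $ 1 / \<nu> z $ 2)"
    using assms(1) neg by (intro continuous_intros) auto
  ultimately have "bounded ((\<lambda>z. \<nu> z $ 1 / \<nu> z $ 2) ` ?S)"
    by (intro compact_imp_bounded compact_continuous_image)
  then obtain K where K: "0 < K" "\<And>z. z \<in> ?S \<Longrightarrow> \<bar>\<nu> z $ 1 / \<nu> z $ 2\<bar> \<le> K"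
    unfolding bounded_pos by auto
  show ?thesis
  proof (rule that[OF K(1)])
    fix z assume "z \<in> cone_side r\<^sub>0"
    then have "z \<in> ?S" using closure_subset by blast
    then have "\<bar>\<nu> z $ 1\<bar> / - \<nu> z $ 2 \<le> K" "0 < - \<nu> z $ 2"
      using K(2)[of z] neg by (auto simp: abs_of_neg)
    then show "\<bar>\<nu> z $ 1\<bar> \<le> K * - \<nu> z $ 2"
      by (simp only: pos_divide_le_eq)
  qed
qed

section \<open>Choice of the constants and verification of the barrier\<close>

theorem lemma4p1:
  fixes \<alpha> a A lip \<theta>\<^sub>F c\<^sub>F :: real
  assumes "\<alpha> > -1"
    and "0 < a" and "a \<le> A"
    and "1/2 < \<theta>\<^sub>F" and "\<theta>\<^sub>F < 1" and "0 < c\<^sub>F"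
  shows "\<exists>c>0. \<forall>r\<^sub>0 \<theta>\<^sub>1 F \<nu>.
    0 < r\<^sub>0 \<longrightarrow> 0 < \<theta>\<^sub>1 \<longrightarrow> \<theta>\<^sub>1 < 2 * pi \<longrightarrow>
    admissible_operator a A lip \<theta>\<^sub>F c\<^sub>F (closure (conical_domain r\<^sub>0 \<theta>\<^sub>1)) F \<longrightarrow>
    continuous_on (closure (cone_side r\<^sub>0)) \<nu> \<longrightarrow>
    (\<forall>z\<in>closure (cone_side r\<^sub>0). \<nu> z $ 2 < 0) \<longrightarrow>
    (\<exists>\<gamma> \<phi>. 0 < \<gamma> \<and> \<gamma> < 1 \<and> C2_on {0..\<theta>\<^sub>1} \<phi> \<and> (\<forall>t\<in>{0..\<theta>\<^sub>1}. \<phi> t \<ge> c) \<and>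
      supersolution_on \<alpha> F (\<lambda>z. c * polar_r z powr (\<gamma> - 2 + (\<gamma> - 1) * \<alpha>)) (barrier \<gamma> \<phi>)
        (conical_domain r\<^sub>0 \<theta>\<^sub>1) \<and>
      (\<forall>z\<in>cone_side r\<^sub>0. oblique_derivative_ge (barrier \<gamma> \<phi>) (\<nu> z)
        (- c * (\<nu> z $ 2) * polar_r z powr (\<gamma> - 1)) z (conical_domain r\<^sub>0 \<theta>\<^sub>1)))"
proof -
  define L where "L = A / a + 1"
  \<comment> \<open>Makes \<open>\<phi> \<ge> 1\<close> on the whole of [0, 2 pi], hence
    independently of \<open>\<theta>\<^sub>1\<close>.\<close>
  define C where "C = exp (2 * pi * L) / L + 1"
  \<comment> \<open>Bounds the angular factor of the gradient: both of its components are at most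
    \<open>exp (2 * pi * L)\<close>.\<close>
  define G where "G = 2 * exp (2 * pi * L)"
  \<comment> \<open>The first entry serves the oblique condition, the second the differential
    inequality; only \<open>a\<close>, \<open>A\<close> and \<alpha> enter.\<close>
  define c where "c = min (1/2) (a * G powr (- \<bar>\<alpha>\<bar>))"
  define \<phi> where "\<phi> t = C - exp (L * t) / L" for t
  have L: "2 \<le> L" using assms by (simp add: L_def)
  have C: "1 < C" using L by (simp add: C_def)
  have c: "0 < c" "c \<le> 1/2" "c \<le> a * G powr (- \<bar>\<alpha>\<bar>)"
    using assms by (auto simp: c_def G_def)
  have exp_bounds: "1 \<le> exp (L * t)" "exp (L * t) \<le> exp (2 * pi * L)" if "0 \<le> t" "t \<le> 2 * pi" for t
    using that L mult_left_mono[OF that(2), of L] by (auto simp: mult.commute)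
  have \<phi>_bounds: "1 \<le> \<phi> t" "\<phi> t \<le> C" if "0 \<le> t" "t \<le> 2 * pi" for t
    using exp_bounds[OF that] L by (auto simp: \<phi>_def C_def divide_right_mono)
  have \<phi>': "(\<phi> has_real_derivative - exp (L * t)) (at t)" for t
    unfolding \<phi>_def using L by (auto intro!: derivative_eq_intros)
  have \<phi>'': "((\<lambda>t. - exp (L * t)) has_real_derivative - (L * exp (L * t))) (at t)" for t
    by (auto intro!: derivative_eq_intros)
  show ?thesis
  proof (rule exI[of _ c], intro conjI allI impI)
    fix r\<^sub>0 \<theta>\<^sub>1 :: real and F :: "real^2 \<Rightarrow> real^2 \<Rightarrow> real^2^2 \<Rightarrow> real" and \<nu> :: "real^2 \<Rightarrow> real^2"
    let ?D = "conical_domain r\<^sub>0 \<theta>\<^sub>1"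
    assume \<theta>\<^sub>1: "0 < \<theta>\<^sub>1" "\<theta>\<^sub>1 < 2 * pi" and F: "admissible_operator a A lip \<theta>\<^sub>F c\<^sub>F (closure ?D) F"
      and \<nu>: "continuous_on (closure (cone_side r\<^sub>0)) \<nu>" "\<forall>z\<in>closure (cone_side r\<^sub>0). \<nu> z $ 2 < 0"
    obtain K where K: "0 < K" "\<And>z. z \<in> cone_side r\<^sub>0 \<Longrightarrow> \<bar>\<nu> z $ 1\<bar> \<le> K * - \<nu> z $ 2"
      using bounded_ratio_on_cone_side[OF \<nu>] by blast
    \<comment> \<open>\<open>1 / C\<close> gives \<open>\<gamma> * \<phi> \<le> 1 \<le> E\<close>,
      as the Hessian estimate requires; \<open>1 / (2 * C * K)\<close> lets the \<nu>-term of the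
      radial derivative cost at most half of \<open>- \<nu> z $ 2\<close>.\<close>
    define \<gamma> where "\<gamma> = min (1/2) (min (1 / C) (1 / (2 * C * K)))"
    have \<gamma>: "0 < \<gamma>" "\<gamma> < 1" "\<gamma> * C \<le> 1" "\<gamma> * C * K \<le> 1/2"
    proof -
      have "\<gamma> \<le> 1 / C" "\<gamma> \<le> 1 / (2 * C * K)" by (auto simp: \<gamma>_def)
      then show "\<gamma> * C \<le> 1" "\<gamma> * C * K \<le> 1/2" using C K by (auto simp: field_simps)
    qed (use C K in \<open>auto simp: \<gamma>_def\<close>)
    have \<gamma>\<phi>: "\<gamma> * \<phi> t \<le> \<gamma> * C" if "0 \<le> t" "t \<le> 2 * pi" for t
      using \<gamma> \<phi>_bounds[OF that] by simp
    have barrier_eq: "barrier \<gamma> \<phi> = (\<lambda>u. norm u powr \<gamma> * \<phi> (polar_angle u))"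
      by (simp add: barrier_def polar_r_eq_norm fun_eq_iff)
    have C2: "C2_on {0..\<theta>\<^sub>1} \<phi>"
      unfolding C2_on_def
    proof (intro exI conjI ballI)
      show "(\<phi> has_real_derivative - exp (L * t)) (at t within {0..\<theta>\<^sub>1})" for t
        by (rule has_field_derivative_at_within[OF \<phi>'])
      show "((\<lambda>t. - exp (L * t)) has_real_derivative - (L * exp (L * t))) (at t within {0..\<theta>\<^sub>1})" for t
        by (rule has_field_derivative_at_within[OF \<phi>''])
      show "continuous_on {0..\<theta>\<^sub>1} (\<lambda>t. - (L * exp (L * t)))"
        by (intro continuous_intros)
    qed
    have ge: "\<forall>t\<in>{0..\<theta>\<^sub>1}. c \<le> \<phi> t"
    proof
      fix t assume "t \<in> {0..\<theta>\<^sub>1}"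
      then have "1 \<le> \<phi> t" using \<theta>\<^sub>1 by (intro \<phi>_bounds) auto
      then show "c \<le> \<phi> t" using c by simp
    qed
    define E where "E z = exp (L * polar_angle z)" for z
    define g where "g z = polar_grad \<gamma> z (\<phi> (polar_angle z)) (- E z)" for z
    define H where "H z = polar_hess \<gamma> z (\<phi> (polar_angle z)) (- E z) (- (L * E z))" for z
    have "has_gradient_hessian_on (barrier \<gamma> \<phi>) g H ?D"
      unfolding has_gradient_hessian_on_def
    proof
      fix z assume "z \<in> ?D"
      then have z: "z \<noteq> 0" "polar_angle z \<noteq> 0"
        by (auto simp: conical_domain_def polar_r_eq_norm)
      note \<Theta> = polar_angle_has_derivative[OF z]
      show "GDERIV (barrier \<gamma> \<phi>) z :> g z \<and> (g has_derivative (\<lambda>h. H z *v h)) (at z)"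
        unfolding gderiv_def g_def H_def E_def barrier_eq
        using polar_has_gradient[OF z(1) \<Theta> \<phi>'] polar_grad_has_derivative[OF z(1) \<Theta> \<phi>' \<phi>'']
        by blast
    qed
    moreover have "c * polar_r z powr (\<gamma> - 2 + (\<gamma> - 1) * \<alpha>) \<le> - (norm (g z) powr \<alpha>) * F z (g z) (H z)"
      if "z \<in> ?D" for z
    proof -
      have z: "z \<noteq> 0" "0 \<le> polar_angle z" "polar_angle z \<le> 2 * pi"
        using that \<theta>\<^sub>1 by (auto simp: conical_domain_def polar_r_eq_norm)
      have E: "1 \<le> E z" "E z \<le> exp (2 * pi * L)"
        using exp_bounds z by (auto simp: E_def)
      have p: "1 \<le> \<phi> (polar_angle z)" "\<gamma> * \<phi> (polar_angle z) \<le> E z"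
        using \<phi>_bounds(1)[OF z(2,3)] \<gamma>\<phi>[OF z(2,3)] \<gamma>(3) E(1) by linarith+
      \<comment> \<open>The gradient has norm \<open>norm z powr (\<gamma> - 1) * m\<close>, with
        \<open>m\<close> between constants free of \<gamma>.\<close>
      define m where "m = sqrt ((\<gamma> * \<phi> (polar_angle z))\<^sup>2 + (E z)\<^sup>2)"
      have m: "1 \<le> m" "m \<le> G"
      proof -
        have "E z \<le> m"
          using real_sqrt_sum_squares_ge2[of "E z" "\<gamma> * \<phi> (polar_angle z)"] by (simp add: m_def)
        then show "1 \<le> m" using E by simp
        have "0 \<le> \<gamma> * \<phi> (polar_angle z)" using p \<gamma> by simp
        then have "m \<le> \<gamma> * \<phi> (polar_angle z) + E z"
          using sqrt_sum_squares_le_sum_abs[of "\<gamma> * \<phi> (polar_angle z)" "- E z"] E by (simp add: m_def)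
        then show "m \<le> G" using p E by (simp add: G_def)
      qed
      have zD: "z \<in> closure ?D"
        using that closure_subset by blast
      have "F z (g z) (H z) \<le> - a * E z * norm z powr (\<gamma> - 2)"
        unfolding H_def L_def using assms \<gamma> p
        by (intro admissible_operator_polar_hess[OF F zD z(1)]) auto
      also have "\<dots> \<le> - a * norm z powr (\<gamma> - 2)"
        using assms(2) mult_right_mono[OF E(1), of "norm z powr (\<gamma> - 2)"] by simp
      finally have "a * norm z powr (\<gamma> - 2) \<le> - F z (g z) (H z)" by simp
      then have "norm (g z) powr \<alpha> * (a * norm z powr (\<gamma> - 2)) \<le> norm (g z) powr \<alpha> * - F z (g z) (H z)"
        by (intro mult_left_mono) auto
      moreover have "norm (g z) powr \<alpha> = norm z powr ((\<gamma> - 1) * \<alpha>) * m powr \<alpha>"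
        using m by (simp add: g_def norm_polar_grad[OF z(1)] m_def[symmetric] powr_mult powr_powr)
      moreover have "c \<le> a * m powr \<alpha>"
        using c(3) powr_ge_powr_minus_abs[OF m, of \<alpha>] assms(2)
        by (meson mult_left_mono less_imp_le order.trans)
      then have "c * (norm z powr (\<gamma> - 2) * norm z powr ((\<gamma> - 1) * \<alpha>))
          \<le> a * m powr \<alpha> * (norm z powr (\<gamma> - 2) * norm z powr ((\<gamma> - 1) * \<alpha>))"
        by (intro mult_right_mono) auto
      ultimately show ?thesis
        by (simp add: polar_r_eq_norm powr_add mult_ac)
    qed
    ultimately have super: "supersolution_on \<alpha> F (\<lambda>z. c * polar_r z powr (\<gamma> - 2 + (\<gamma> - 1) * \<alpha>))
        (barrier \<gamma> \<phi>) ?D"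
      unfolding supersolution_on_def by blast
    have oblique: "oblique_derivative_ge (barrier \<gamma> \<phi>) (\<nu> z) (- c * (\<nu> z $ 2) * polar_r z powr (\<gamma> - 1)) z ?D"
      if "z \<in> cone_side r\<^sub>0" for z
      unfolding oblique_derivative_ge_def
    proof (intro exI[of _ "g z"] conjI)
      have z: "z \<noteq> 0" "polar_angle z = 0"
        using that by (auto simp: cone_side_def polar_r_eq_norm)
      show "(barrier \<gamma> \<phi> has_derivative (\<lambda>h. h \<bullet> g z)) (at z within closure ?D)"
        unfolding g_def E_def barrier_eq
        by (rule polar_has_gradient[OF z(1) polar_angle_has_derivative_side[OF \<theta>\<^sub>1(2) z] \<phi>'])
      have z12: "z$2 = 0" "0 < z$1" using z polar_angle_eq_0_iff by auto
      then have norm_z: "norm z = z$1"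
        by (simp add: norm_vec_def L2_set_def sum_2)
      have neg: "\<nu> z $ 2 < 0" using that \<nu>(2) closure_subset by blast
      \<comment> \<open>Half of \<open>- \<nu> z $ 2\<close> compensates the first component of
        \<nu>, and the other half dominates \<open>c * - \<nu> z $ 2\<close>.\<close>
      have "\<gamma> * \<phi> 0 * \<bar>\<nu> z $ 1\<bar> \<le> \<gamma> * C * (K * - \<nu> z $ 2)"
        using \<gamma> \<gamma>\<phi>[of 0] K(2)[OF that] C by (intro mult_mono[of "\<gamma> * \<phi> 0"]) auto
      also have "\<dots> \<le> 1/2 * - \<nu> z $ 2"
        using mult_right_mono[OF \<gamma>(4), of "- \<nu> z $ 2"] neg by (simp add: mult_ac)
      finally have "\<gamma> * \<phi> 0 * \<bar>\<nu> z $ 1\<bar> \<le> 1/2 * - \<nu> z $ 2" .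
      moreover have "- (\<gamma> * \<phi> 0 * \<bar>\<nu> z $ 1\<bar>) \<le> \<gamma> * \<phi> 0 * \<nu> z $ 1"
        using \<gamma> \<phi>_bounds(1)[of 0] mult_left_mono[of "- \<bar>\<nu> z $ 1\<bar>" "\<nu> z $ 1" "\<gamma> * \<phi> 0"] by auto
      moreover have "c * - \<nu> z $ 2 \<le> 1/2 * - \<nu> z $ 2"
        using c(2) neg by (intro mult_right_mono) auto
      ultimately have "- c * \<nu> z $ 2 \<le> \<gamma> * \<phi> 0 * \<nu> z $ 1 - \<nu> z $ 2"
        by simp
      then have "- c * \<nu> z $ 2 * norm z powr (\<gamma> - 1)
          \<le> (\<gamma> * \<phi> 0 * \<nu> z $ 1 - \<nu> z $ 2) * norm z powr (\<gamma> - 1)"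
        by (intro mult_right_mono) auto
      also have "\<dots> = g z \<bullet> \<nu> z"
      proof -
        have "norm z powr (\<gamma> - 1) = norm z powr (\<gamma> - 2) * z$1"
          using z12 norm_z powr_add[of "norm z" "\<gamma> - 2" 1] by simp
        then show ?thesis
          using z z12 by (simp add: g_def E_def polar_grad_def inner_real2 algebra_simps)
      qed
      finally show "- c * (\<nu> z $ 2) * polar_r z powr (\<gamma> - 1) \<le> g z \<bullet> \<nu> z"
        by (simp add: polar_r_eq_norm)
    qed
    show "\<exists>\<gamma> \<phi>. 0 < \<gamma> \<and> \<gamma> < 1 \<and> C2_on {0..\<theta>\<^sub>1} \<phi> \<and> (\<forall>t\<in>{0..\<theta>\<^sub>1}. \<phi> t \<ge> c) \<and>
      supersolution_on \<alpha> F (\<lambda>z. c * polar_r z powr (\<gamma> - 2 + (\<gamma> - 1) * \<alpha>)) (barrier \<gamma> \<phi>) ?D \<and>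
      (\<forall>z\<in>cone_side r\<^sub>0. oblique_derivative_ge (barrier \<gamma> \<phi>) (\<nu> z)
        (- c * (\<nu> z $ 2) * polar_r z powr (\<gamma> - 1)) z ?D)"
      using \<gamma> C2 ge super oblique by blast
  qed (rule c(1))
qed

end
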